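(* Let $(V_i,v_i,\varphi^{(i)})_{i\in I}$ be a fusion frame system for $\mathcal{H}$ and let $v\varphi=(v_i\varphi_{ij})_{i\in I,j\in J_i}$ be the corresponding global frame. Then the following hold: $$D_{v\varphi}=D_V\bigoplus_{i\in I}D_{\varphi^{(i)}},$$ $$C_{v\varphi}=\Big(\bigoplus_{i\in I}C_{\varphi^{(i)}}\Big)C_V,$$ $$S_{v\varphi}=D_V\Big(\bigoplus_{i\in I}S_{\varphi^{(i)}}\Big)C_V.$$
   Context: $\mathcal{H}$ is a separable Hilbert space; $\pi_U$ denotes the orthogonal projection onto a closed subspace $U$. A frame for a Hilbert space $K$ is a countable family $\psi=(\psi_j)_{j\in J}$ in $K$ with constants $0<A\le B<\infty$ (frame bounds) such that $A\|f\|^2\le\sum_j|\langle f,\psi_j\rangle|^2\le B\|f\|^2$ for all $f\in K$. Its associated bounded operators are the synthesis operator $D_\psi:\ell^2(J)\to K$, $D_\psi(c_j)_j=\sum_jc_j\psi_j$; the analysis operator $C_\psi:K\to\ell^2(J)$, $C_\psi f=(\langle f,\psi_j\rangle)_j$; the frame operator $S_\psi:K\to K$, $S_\psi f=\sum_j\langle f,\psi_j\rangle\psi_j$. For Hilbert spaces $V_i$ ($i\in I$), the Hilbert direct sum is $(\sum_{i\in I}\oplus V_i)_{\ell^2}=\{(f_i)_{i\in I}:f_i\in V_i,\ \sum_i\|f_i\|^2<\infty\}$ with inner product $\sum_i\langle f_i,g_i\rangle_{V_i}$. For bounded operators $\mathcal{O}_i:V_i\to W_i$ with $\sup_i\|\mathcal{O}_i\|<\infty$,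 $\bigoplus_{i\in I}\mathcal{O}_i$ is the bounded operator $(\sum_i\oplus V_i)_{\ell^2}\to(\sum_i\oplus W_i)_{\ell^2}$, $(f_i)_i\mapsto(\mathcal{O}_if_i)_i$. A fusion frame for $\mathcal{H}$ is a countable family $V=(V_i,v_i)_{i\in I}$ of closed subspaces with weights $v_i>0$ for which there are constants $0<A_V\le B_V<\infty$ with $A_V\|f\|^2\le\sum_{i} v_i^2\|\pi_{V_i}f\|^2\le B_V\|f\|^2$ for all $f\in\mathcal{H}$. Its associated bounded operators are $D_V:(\sum_i\oplus V_i)_{\ell^2}\to\mathcal{H}$, $D_V(f_i)_i=\sum_iv_if_i$; $C_V:\mathcal{H}\to(\sum_i\oplus V_i)_{\ell^2}$, $C_Vf=(v_i\pi_{V_i}f)_i$; $S_V:\mathcal{H}\to\mathcal{H}$, $S_Vf=\sum_iv_i^2\pi_{V_i}f$. A fusion frame system $(V_i,v_i,\varphi^{(i)})_{i\in I}$ for $\mathcal{H}$ consists of a fusion frame $V=(V_i,v_i)_{i\in I}$ for $\mathcal{H}$ and, for every $i\in I$, a frame $\varphi^{(i)}=(\varphi_{ij})_{j\in J_i}$ for $V_i$, such that these local frames have common frame bounds $0<A\le B<\infty$. Its global frame is $v\varphi=(v_i\varphi_{ij})_{i\in I,j\in J_i}$, which is a frame for $\mathcal{H}$ with coefficient space $\ell^2(\biguplus_{i\in I}J_i)$ of square-summable families $(c_{ij})_{i\in I,j\in J_i}$. This space is identified with $(\sum_{i\in I}\oplus\ell^2(J_i))_{\ell^2}$ via the isometric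 isomorphism $(c_{ij})_{i,j}\mapsto((c_{ij})_{j\in J_i})_{i\in I}$. *)

theory Defs
  imports "HOL-Analysis.Analysis"
begin

text \<open>
  The scalar field is real or complex. The class below treats both at once; conversely,
  by the Gelfand--Mazur theorem, its only models are the reals and the complex numbers.
\<close>

class hilbert_scalar = real_normed_field + complete_space +
  fixes sconj :: "'a \<Rightarrow> 'a"
  assumes sconj_add: "sconj (x + y) = sconj x + sconj y"
    and sconj_mult: "sconj (x * y) = sconj x * sconj y"
    and sconj_scaleR: "sconj (r *\<^sub>R x) = r *\<^sub>R sconj x"
    and mult_sconj: "x * sconj x = ((norm x)\<^sup>2) *\<^sub>R 1"

instantiation real :: hilbert_scalar
begin
definition sconj_real :: "real \<Rightarrow> real" where "sconj_real x = x"
instance by standard (auto simp: sconj_real_def power2_eq_square)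
end

instantiation complex :: hilbert_scalar
begin
definition sconj_complex :: "complex \<Rightarrow> complex" where "sconj_complex = cnj"
instance
proof
  fix x :: complex
  show "x * sconj x = ((norm x)\<^sup>2) *\<^sub>R 1"
    by (simp only: sconj_complex_def complex_norm_square[symmetric] scaleR_conv_of_real mult_1_right)
qed (simp_all add: sconj_complex_def)
end

text \<open>
  A separable Hilbert space over \<open>'k\<close>, carried by the whole type \<open>'a\<close>: completeness comes from
  \<^class>\<open>banach\<close> and separability from \<^class>\<open>second_countable_topology\<close> (equivalent to it for
  metric spaces). The inner product is linear in the first argument.
\<close>

locale hilbert_space = vector_space smul
  for smul :: "'k::hilbert_scalar \<Rightarrow> 'a::{banach,second_countable_topology} \<Rightarrow> 'a" +
  fixes ip :: "'a \<Rightarrow> 'a \<Rightarrow> 'k"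
  assumes ip_add_left: "ip (x + y) z = ip x z + ip y z"
    and ip_scale_left: "ip (smul a x) y = a * ip x y"
    and ip_commute: "ip y x = sconj (ip x y)"
    and ip_self: "ip x x = of_real ((norm x)\<^sup>2)"
    and scale_of_real: "smul (of_real r) x = r *\<^sub>R x"

lemma hilbert_space_real:
  "hilbert_space (*\<^sub>R) (inner :: 'a::{real_inner,banach,second_countable_topology} \<Rightarrow> 'a \<Rightarrow> real)"
proof unfold_locales
  fix x y :: 'a
  show "inner y x = sconj (inner x y)"
    unfolding sconj_real_def by (rule inner_commute)
qed (simp_all add: scaleR_add_right scaleR_add_left inner_add_left power2_norm_eq_inner)

lemma hilbert_space_complex: "hilbert_space (*) (\<lambda>x y :: complex. x * cnj y)"
proof unfold_locales
  fix x :: complex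
  show "x * cnj x = of_real ((norm x)\<^sup>2)"
    by (simp only: complex_norm_square)
qed (simp_all add: distrib_left distrib_right sconj_complex_def scaleR_conv_of_real)

definition closed_subspace :: "('k::field \<Rightarrow> 'a::{topological_space,ab_group_add} \<Rightarrow> 'a) \<Rightarrow> 'a set \<Rightarrow> bool"
  where "closed_subspace smul U \<longleftrightarrow> module.subspace smul U \<and> closed U"

definition proj :: "('a::ab_group_add \<Rightarrow> 'a \<Rightarrow> 'k::zero) \<Rightarrow> 'a set \<Rightarrow> 'a \<Rightarrow> 'a"
  where "proj ip U f = (THE p. p \<in> U \<and> (\<forall>u\<in>U. ip (f - p) u = 0))"


subsection \<open>Hilbert direct sums\<close>

text \<open>
  The spaces \<open>X i\<close> are given by carrier sets with their norms \<open>N i\<close>. Elements of the direct sum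
  are extensional functions on \<open>I\<close> (equal to \<^const>\<open>undefined\<close> outside \<open>I\<close>), so that equality of
  families indexed by \<open>I\<close> is equality of functions. Operators are likewise extensional on their
  domain. The space \<open>l2 J\<close> is the direct sum of copies of the scalar field.
\<close>

definition hilbert_sum :: "'i set \<Rightarrow> ('i \<Rightarrow> 'x set) \<Rightarrow> ('i \<Rightarrow> 'x \<Rightarrow> real) \<Rightarrow> ('i \<Rightarrow> 'x) set"
  where "hilbert_sum I X N = {f \<in> Pi\<^sub>E I X. (\<lambda>i. (N i (f i))\<^sup>2) summable_on I}"

definition hilbert_sum_norm :: "'i set \<Rightarrow> ('i \<Rightarrow> 'x \<Rightarrow> real) \<Rightarrow> ('i \<Rightarrow> 'x) \<Rightarrow> real"
  where "hilbert_sum_norm I N f = sqrt (\<Sum>\<^sub>\<infinity>i\<in>I. (N i (f i))\<^sup>2)"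

definition hilbert_sum_op :: "'i set \<Rightarrow> ('i \<Rightarrow> 'x set) \<Rightarrow> ('i \<Rightarrow> 'x \<Rightarrow> real) \<Rightarrow> ('i \<Rightarrow> 'x \<Rightarrow> 'y)
    \<Rightarrow> ('i \<Rightarrow> 'x) \<Rightarrow> ('i \<Rightarrow> 'y)"
  where "hilbert_sum_op I X N T = (\<lambda>f\<in>hilbert_sum I X N. \<lambda>i\<in>I. T i (f i))"

definition l2 :: "'j set \<Rightarrow> ('j \<Rightarrow> 'k::real_normed_vector) set"
  where "l2 J = hilbert_sum J (\<lambda>_. UNIV) (\<lambda>_. norm)"

definition l2_norm :: "'j set \<Rightarrow> ('j \<Rightarrow> 'k::real_normed_vector) \<Rightarrow> real"
  where "l2_norm J = hilbert_sum_norm J (\<lambda>_. norm)"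

text \<open>The identification of \<open>l2\<close> of a disjoint union with the direct sum of the \<open>l2 (J i)\<close>.\<close>

definition l2_split :: "'i set \<Rightarrow> ('i \<Rightarrow> 'j set) \<Rightarrow> ('i \<times> 'j \<Rightarrow> 'k::real_normed_vector)
    \<Rightarrow> ('i \<Rightarrow> 'j \<Rightarrow> 'k)"
  where "l2_split I J = (\<lambda>c\<in>l2 (Sigma I J). \<lambda>i\<in>I. \<lambda>j\<in>J i. c (i, j))"


subsection \<open>Frames\<close>

text \<open>
  \<open>K\<close> is the closed subspace for which the family \<open>\<psi>\<close> is a frame. All series are
  unconditional sums (\<^const>\<open>infsum\<close>); for frames and fusion frames, and for arguments in the
  stated domains, they converge. In the frame inequalities, where convergence is part of the
  condition, it is required explicitly.
\<close>

definition frame_with_bounds :: "('a::real_normed_vector \<Rightarrow> 'a \<Rightarrow> 'k::real_normed_vector) \<Rightarrow> 'a set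
    \<Rightarrow> 'j set \<Rightarrow> ('j \<Rightarrow> 'a) \<Rightarrow> real \<Rightarrow> real \<Rightarrow> bool"
  where "frame_with_bounds ip K J \<psi> A B \<longleftrightarrow>
    countable J \<and> (\<forall>j\<in>J. \<psi> j \<in> K) \<and> 0 < A \<and> A \<le> B \<and>
    (\<forall>f\<in>K. (\<lambda>j. (norm (ip f (\<psi> j)))\<^sup>2) summable_on J \<and>
      A * (norm f)\<^sup>2 \<le> (\<Sum>\<^sub>\<infinity>j\<in>J. (norm (ip f (\<psi> j)))\<^sup>2) \<and>
      (\<Sum>\<^sub>\<infinity>j\<in>J. (norm (ip f (\<psi> j)))\<^sup>2) \<le> B * (norm f)\<^sup>2)"

definition synthesis :: "('k::real_normed_vector \<Rightarrow> 'a::real_normed_vector \<Rightarrow> 'a) \<Rightarrow> 'j set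
    \<Rightarrow> ('j \<Rightarrow> 'a) \<Rightarrow> ('j \<Rightarrow> 'k) \<Rightarrow> 'a"
  where "synthesis smul J \<psi> = (\<lambda>c\<in>l2 J. \<Sum>\<^sub>\<infinity>j\<in>J. smul (c j) (\<psi> j))"

definition analysis :: "('a \<Rightarrow> 'a \<Rightarrow> 'k) \<Rightarrow> 'a set \<Rightarrow> 'j set \<Rightarrow> ('j \<Rightarrow> 'a) \<Rightarrow> 'a \<Rightarrow> ('j \<Rightarrow> 'k)"
  where "analysis ip K J \<psi> = (\<lambda>f\<in>K. \<lambda>j\<in>J. ip f (\<psi> j))"

definition frame_operator :: "('k \<Rightarrow> 'a::real_normed_vector \<Rightarrow> 'a) \<Rightarrow> ('a \<Rightarrow> 'a \<Rightarrow> 'k) \<Rightarrow> 'a set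
    \<Rightarrow> 'j set \<Rightarrow> ('j \<Rightarrow> 'a) \<Rightarrow> 'a \<Rightarrow> 'a"
  where "frame_operator smul ip K J \<psi> = (\<lambda>f\<in>K. \<Sum>\<^sub>\<infinity>j\<in>J. smul (ip f (\<psi> j)) (\<psi> j))"


subsection \<open>Fusion frames and fusion frame systems\<close>

definition fusion_frame :: "('k::field \<Rightarrow> 'a::real_normed_vector \<Rightarrow> 'a) \<Rightarrow> ('a \<Rightarrow> 'a \<Rightarrow> 'k)
    \<Rightarrow> 'i set \<Rightarrow> ('i \<Rightarrow> 'a set) \<Rightarrow> ('i \<Rightarrow> real) \<Rightarrow> bool"
  where "fusion_frame smul ip I V v \<longleftrightarrow>
    countable I \<and> (\<forall>i\<in>I. closed_subspace smul (V i) \<and> 0 < v i) \<and>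
    (\<exists>A B. 0 < A \<and> A \<le> B \<and>
      (\<forall>f. (\<lambda>i. (v i)\<^sup>2 * (norm (proj ip (V i) f))\<^sup>2) summable_on I \<and>
        A * (norm f)\<^sup>2 \<le> (\<Sum>\<^sub>\<infinity>i\<in>I. (v i)\<^sup>2 * (norm (proj ip (V i) f))\<^sup>2) \<and>
        (\<Sum>\<^sub>\<infinity>i\<in>I. (v i)\<^sup>2 * (norm (proj ip (V i) f))\<^sup>2) \<le> B * (norm f)\<^sup>2))"

definition fusion_synthesis :: "'i set \<Rightarrow> ('i \<Rightarrow> 'a::real_normed_vector set) \<Rightarrow> ('i \<Rightarrow> real)
    \<Rightarrow> ('i \<Rightarrow> 'a) \<Rightarrow> 'a"
  where "fusion_synthesis I V v = (\<lambda>f\<in>hilbert_sum I V (\<lambda>_. norm). \<Sum>\<^sub>\<infinity>i\<in>I. v i *\<^sub>R f i)"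

definition fusion_analysis :: "('a::real_normed_vector \<Rightarrow> 'a \<Rightarrow> 'k::zero) \<Rightarrow> 'i set \<Rightarrow> ('i \<Rightarrow> 'a set)
    \<Rightarrow> ('i \<Rightarrow> real) \<Rightarrow> 'a \<Rightarrow> ('i \<Rightarrow> 'a)"
  where "fusion_analysis ip I V v = (\<lambda>f. \<lambda>i\<in>I. v i *\<^sub>R proj ip (V i) f)"

definition fusion_frame_system :: "('k::hilbert_scalar \<Rightarrow> 'a::real_normed_vector \<Rightarrow> 'a)
    \<Rightarrow> ('a \<Rightarrow> 'a \<Rightarrow> 'k) \<Rightarrow> 'i set \<Rightarrow> ('i \<Rightarrow> 'a set) \<Rightarrow> ('i \<Rightarrow> real) \<Rightarrow> ('i \<Rightarrow> 'j set)
    \<Rightarrow> ('i \<Rightarrow> 'j \<Rightarrow> 'a) \<Rightarrow> bool"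
  where "fusion_frame_system smul ip I V v J \<phi> \<longleftrightarrow>
    fusion_frame smul ip I V v \<and>
    (\<exists>A B. 0 < A \<and> A \<le> B \<and> (\<forall>i\<in>I. frame_with_bounds ip (V i) (J i) (\<phi> i) A B))"

definition global_frame :: "('i \<Rightarrow> real) \<Rightarrow> ('i \<Rightarrow> 'j \<Rightarrow> 'a::real_normed_vector) \<Rightarrow> 'i \<times> 'j \<Rightarrow> 'a"
  where "global_frame v \<phi> = (\<lambda>(i, j). v i *\<^sub>R \<phi> i j)"

end

theory Submission
  imports Defs
begin

text \<open>
  Since \<open>\<phi> i j \<in> V i\<close>, one has \<open>\<langle>f, v i \<phi> i j\<rangle> = \<langle>v i \<pi> f, \<phi> i j\<rangle>\<close> with \<open>\<pi>\<close> the projection onto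
  \<open>V i\<close>; this is the identity for the analysis operators. Summing squares, first over \<open>j\<close>
  and then over \<open>i\<close>, it also shows that the global frame is a frame. The upper frame bound makes
  every synthesis series unconditionally convergent, so the global series may be summed over \<open>j\<close>
  first, which gives the identity for the synthesis operators and, applied to the analysis
  coefficients, the one for the frame operators.
\<close>

section \<open>Unconditional summation in Banach spaces\<close>

lemma has_sum_in_closed:
  fixes f :: "'j \<Rightarrow> 'a::{comm_monoid_add,topological_space}"
  assumes "(f has_sum s) J" "closed C" "\<And>F. finite F \<Longrightarrow> F \<subseteq> J \<Longrightarrow> sum f F \<in> C"
  shows "s \<in> C"
proof (rule Lim_in_closed_set[OF assms(2)])
  show "\<forall>\<^sub>F F in finite_subsets_at_top J. sum f F \<in> C"
    using assms(3) by (intro eventually_finite_subsets_at_top_weakI) auto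
  show "(sum f \<longlongrightarrow> s) (finite_subsets_at_top J)"
    using assms(1) by (simp add: has_sum_def)
qed simp

text \<open>The Cauchy criterion along finite subsets: once a finite set carries nearly all of the
  sum of \<open>g\<close>, adding further indices changes the partial sums of \<open>f\<close> only
  slightly, and completeness supplies the limit. Absolute convergence of \<open>f\<close> is not
  claimed.\<close>

lemma summable_on_square_bound:
  fixes f :: "'j \<Rightarrow> 'a::banach" and g :: "'j \<Rightarrow> real"
  assumes g: "g summable_on J" "\<And>j. j \<in> J \<Longrightarrow> 0 \<le> g j"
    and B: "0 < B"
    and bound: "\<And>F. finite F \<Longrightarrow> F \<subseteq> J \<Longrightarrow> (norm (sum f F))\<^sup>2 \<le> B * sum g F"
  shows "f summable_on J" and "(norm (infsum f J))\<^sup>2 \<le> B * infsum g J"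
proof -
  have le: "sum g F \<le> infsum g J" if "finite F" "F \<subseteq> J" for F
    using g that by (intro finite_sum_le_infsum) auto
  have "\<exists>P. eventually P (finite_subsets_at_top J) \<and>
      (\<forall>F F'. P F \<and> P F' \<longrightarrow> dist (sum f F) (sum f F') < e)" if "e > 0" for e
  proof -
    have "(e/2)\<^sup>2 / B > 0" using that B by simp
    \<comment> \<open>Multiplied by \<open>B\<close>, the tail bound
      \<open>(e/2)\<^sup>2 / B\<close> becomes the square of \<open>e/2\<close>. The extra factor
      1/2 turns the weak inequality of the approximation result into the strict one needed
      below.\<close>
    then have "\<exists>F0. finite F0 \<and> F0 \<subseteq> J \<and> dist (sum g F0) (infsum g J) \<le> (e/2)\<^sup>2 / B / 2"
      using infsum_finite_approximation[OF g(1), of "(e/2)\<^sup>2 / B / 2"] by auto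
    then obtain F0 where F0: "finite F0" "F0 \<subseteq> J"
      and d: "infsum g J - sum g F0 < (e/2)\<^sup>2 / B"
      using \<open>(e/2)\<^sup>2 / B > 0\<close> by (auto simp: dist_real_def abs_le_iff)
    \<comment> \<open>The hypothesis \<open>bound\<close> is applied to \<open>F - F0\<close>, whose
      \<open>g\<close>-sum is at most the tail of \<open>g\<close> beyond \<open>F0\<close>.\<close>
    have close: "dist (sum f F) (sum f F0) < e/2" if F: "finite F" "F \<subseteq> J" "F0 \<subseteq> F" for F
    proof -
      have "(norm (sum f F - sum f F0))\<^sup>2 = (norm (sum f (F - F0)))\<^sup>2"
        using F by (simp add: sum_diff)
      also have "\<dots> \<le> B * sum g (F - F0)"
        using F by (intro bound) auto
      also have "\<dots> = B * (sum g F - sum g F0)"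
        using F by (simp add: sum_diff)
      also have "\<dots> \<le> B * (infsum g J - sum g F0)"
        using le[OF F(1,2)] B by simp
      also have "\<dots> < (e/2)\<^sup>2"
        using d B by (simp add: field_simps)
      finally show ?thesis
        unfolding dist_norm by (rule power_less_imp_less_base) (use \<open>e > 0\<close> in simp)
    qed
    have "dist (sum f F) (sum f F') < e"
      if "finite F \<and> F \<subseteq> J \<and> F0 \<subseteq> F" "finite F' \<and> F' \<subseteq> J \<and> F0 \<subseteq> F'" for F F'
      using close[of F] close[of F'] that
      by (metis dist_commute dist_triangle_half_l)
    moreover have "\<forall>\<^sub>F F in finite_subsets_at_top J. finite F \<and> F \<subseteq> J \<and> F0 \<subseteq> F"
      unfolding eventually_finite_subsets_at_top by (rule exI[of _ F0]) (use F0 in auto)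
    ultimately show ?thesis
      by (intro exI[of _ "\<lambda>F. finite F \<and> F \<subseteq> J \<and> F0 \<subseteq> F"]) simp
  qed
  then have "cauchy_filter (filtermap (sum f) (finite_subsets_at_top J))"
    by (simp add: cauchy_filter_metric_filtermap)
  moreover have "complete (UNIV :: 'a set)"
    by (meson Cauchy_convergent UNIV_I complete_def convergent_def)
  ultimately obtain L where "(sum f \<longlongrightarrow> L) (finite_subsets_at_top J)"
    using complete_uniform[where S = "UNIV :: 'a set"] by (force simp add: filterlim_def)
  then show sm: "f summable_on J"
    by (auto simp: summable_on_def has_sum_def)
  have pos: "0 \<le> infsum g J" using g(2) by (rule infsum_nonneg)
  \<comment> \<open>The bound survives the limit because it confines all partial sums to one closed
    ball.\<close>
  have "infsum f J \<in> cball 0 (sqrt (B * infsum g J))"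
  proof (rule has_sum_in_closed[OF has_sum_infsum[OF sm]])
    fix F assume F: "finite F" "F \<subseteq> J"
    have "(norm (sum f F))\<^sup>2 \<le> B * infsum g J"
      by (rule order_trans[OF bound[OF F] mult_left_mono[OF le[OF F]]]) (use B in simp)
    then show "sum f F \<in> cball 0 (sqrt (B * infsum g J))"
      by (simp add: real_le_rsqrt)
  qed simp
  then have "(norm (infsum f J))\<^sup>2 \<le> (sqrt (B * infsum g J))\<^sup>2"
    by (intro power_mono) auto
  then show "(norm (infsum f J))\<^sup>2 \<le> B * infsum g J"
    using pos B by simp
qed

section \<open>Conjugation and the algebra of the inner product\<close>

lemma sconj_zero [simp]: "sconj 0 = (0::'k::hilbert_scalar)"
  using sconj_scaleR[of 0 "0::'k"] by simp

text \<open>Taking norms in \<open>mult_sconj\<close> gives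
  \<open>norm x * norm (sconj x) = (norm x)\<^sup>2\<close>, where \<open>norm x\<close> cancels
  unless it is zero.\<close>

lemma norm_sconj [simp]: "norm (sconj (x::'k::hilbert_scalar)) = norm x"
proof (cases "x = 0")
  case False
  have "norm x * norm (sconj x) = (norm x)\<^sup>2"
    by (simp add: norm_mult[symmetric] mult_sconj)
  with False show ?thesis by (simp add: power2_eq_square)
qed simp

context hilbert_space
begin

lemma ip_zero_left [simp]: "ip 0 y = 0"
  using ip_add_left[of 0 0 y] by simp

lemma ip_minus_left: "ip (- x) y = - ip x y"
  using ip_add_left[of "- x" x y] by (simp add: eq_neg_iff_add_eq_0)

lemma ip_diff_left: "ip (x - y) z = ip x z - ip y z"
  using ip_add_left[of x "- y" z] by (simp add: ip_minus_left)

lemma ip_add_right: "ip x (y + z) = ip x y + ip x z"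
  using arg_cong[OF ip_add_left[of y z x], of sconj] by (simp only: sconj_add ip_commute[symmetric])

lemma ip_zero_right [simp]: "ip x 0 = 0"
  using ip_add_right[of x 0 0] by simp

lemma ip_minus_right: "ip x (- y) = - ip x y"
  using ip_add_right[of x "- y" y] by (simp add: eq_neg_iff_add_eq_0)

lemma ip_scaleR_left: "ip (r *\<^sub>R x) y = of_real r * ip x y"
  using ip_scale_left[of "of_real r"] by (simp add: scale_of_real)

lemma ip_scaleR_right: "ip x (r *\<^sub>R y) = of_real r * ip x y"
  using arg_cong[OF ip_scaleR_left[of r y x], of sconj]
  by (simp only: scaleR_conv_of_real[symmetric] sconj_scaleR ip_commute[symmetric])

lemma ip_sum_left: "ip (sum f F) y = (\<Sum>j\<in>F. ip (f j) y)"
  by (induction F rule: infinite_finite_induct) (auto simp: ip_add_left)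

lemma norm_ip_commute: "norm (ip x y) = norm (ip y x)"
  by (subst ip_commute) (rule norm_sconj)

lemma ip_self_eq_0: "ip x x = 0 \<longleftrightarrow> x = 0"
  by (simp add: ip_self)

lemma smul_scaleR_right: "smul a (r *\<^sub>R x) = r *\<^sub>R smul a x"
  using scale_left_commute[of a "of_real r" x] by (simp only: scale_of_real)

text \<open>The cross terms cancel when the squares are expanded as inner products. The computation
  takes place in the scalar field and returns to the reals by injectivity of
  \<open>of_real\<close>.\<close>

lemma parallelogram:
  fixes x y :: 'a
  shows "(norm (x + y))\<^sup>2 + (norm (x - y))\<^sup>2 = 2 * (norm x)\<^sup>2 + 2 * (norm y)\<^sup>2"
proof -
  have "ip (x + y) (x + y) + ip (x - y) (x - y) = 2 * ip x x + 2 * ip y y"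
    using ip_add_left[of x "- y"] ip_add_right[of _ x "- y"]
    by (simp add: ip_add_left ip_add_right ip_minus_left ip_minus_right)
  then have "(of_real ((norm (x + y))\<^sup>2 + (norm (x - y))\<^sup>2) :: 'k)
      = of_real (2 * (norm x)\<^sup>2 + 2 * (norm y)\<^sup>2)"
    by (simp add: ip_self)
  then show ?thesis by (simp only: of_real_eq_iff)
qed

lemma pythagoras:
  assumes "ip x y = 0"
  shows "(norm (x + y))\<^sup>2 = (norm x)\<^sup>2 + (norm y)\<^sup>2"
proof -
  have "ip y x = 0" using assms ip_commute[of y x] by simp
  with assms have "ip (x + y) (x + y) = ip x x + ip y y"
    by (simp add: ip_add_left ip_add_right)
  then have "(of_real ((norm (x + y))\<^sup>2) :: 'k) = of_real ((norm x)\<^sup>2 + (norm y)\<^sup>2)"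
    by (simp add: ip_self)
  then show ?thesis by (simp only: of_real_eq_iff)
qed

section \<open>Closed subspaces and orthogonal projections\<close>

lemma closed_subspaceD:
  assumes "closed_subspace smul U"
  shows "subspace U" "closed U" "0 \<in> U" "x \<in> U \<Longrightarrow> y \<in> U \<Longrightarrow> x + y \<in> U"
    "x \<in> U \<Longrightarrow> y \<in> U \<Longrightarrow> x - y \<in> U" "x \<in> U \<Longrightarrow> smul a x \<in> U" "x \<in> U \<Longrightarrow> r *\<^sub>R x \<in> U"
proof -
  show s: "subspace U" and "closed U"
    using assms by (auto simp: closed_subspace_def)
  show "0 \<in> U" using s by (rule subspace_0)
  show "x \<in> U \<Longrightarrow> y \<in> U \<Longrightarrow> x + y \<in> U" using s by (rule subspace_add)
  show "x \<in> U \<Longrightarrow> y \<in> U \<Longrightarrow> x - y \<in> U" using s by (rule subspace_diff)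
  show "x \<in> U \<Longrightarrow> smul a x \<in> U" using s by (rule subspace_scale)
  show "x \<in> U \<Longrightarrow> r *\<^sub>R x \<in> U" using subspace_scale[OF s, of x "of_real r"] by (simp add: scale_of_real)
qed

lemma closed_subspace_UNIV: "closed_subspace smul UNIV"
  by (simp add: closed_subspace_def)

text \<open>A minimizing sequence is Cauchy by the parallelogram law. Its limit stays in
  \<open>U\<close> by closedness and attains the infimum by continuity of the norm.\<close>

lemma nearest_point_exists:
  assumes U: "closed_subspace smul U"
  obtains p where "p \<in> U" "\<And>u. u \<in> U \<Longrightarrow> norm (f - p) \<le> norm (f - u)"
proof -
  note Us = closed_subspaceD[OF U]
  define D where "D = (\<lambda>u. (norm (f - u))\<^sup>2) ` U"
  define d where "d = Inf D"
  have bdd: "bdd_below D" and ne: "D \<noteq> {}"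
    using Us(3) by (auto simp: D_def intro!: bdd_belowI[of _ 0])
  have d_le: "d \<le> (norm (f - u))\<^sup>2" if "u \<in> U" for u
    unfolding d_def using that bdd by (intro cInf_lower) (auto simp: D_def)
  have "\<exists>u\<in>U. (norm (f - u))\<^sup>2 < d + inverse (real (Suc n))" for n
    using cInf_lessD[OF ne, of "d + inverse (real (Suc n))"]
    by (auto simp: d_def[symmetric]) (auto simp: D_def)
  then obtain w where w: "\<And>n. w n \<in> U" "\<And>n. (norm (f - w n))\<^sup>2 < d + inverse (real (Suc n))"
    by metis
  \<comment> \<open>The midpoint of \<open>w n\<close> and \<open>w m\<close> lies in
    \<open>U\<close>, so its squared distance to \<open>f\<close> is at least \<open>d\<close>. The
    parallelogram law then leaves twice the excess of each of the two points over
    \<open>d\<close>.\<close>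
  have gap: "(norm (w n - w m))\<^sup>2 \<le> 2 * inverse (real (Suc n)) + 2 * inverse (real (Suc m))" for n m
  proof -
    have "(1/2) *\<^sub>R (w n + w m) \<in> U" using w Us(4,7) by simp
    then have "d \<le> (norm (f - (1/2) *\<^sub>R (w n + w m)))\<^sup>2" by (rule d_le)
    then have "4 * d \<le> (norm (2 *\<^sub>R (f - (1/2) *\<^sub>R (w n + w m))))\<^sup>2"
      by (simp add: power_mult_distrib)
    also have "2 *\<^sub>R (f - (1/2) *\<^sub>R (w n + w m)) = (f - w n) + (f - w m)"
      by (simp add: scaleR_right_diff_distrib scaleR_2)
    finally have "4 * d \<le> (norm ((f - w n) + (f - w m)))\<^sup>2" .
    moreover have "norm ((f - w n) - (f - w m)) = norm (w n - w m)"
      by (simp add: norm_minus_commute)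
    ultimately show ?thesis
      using parallelogram[of "f - w n" "f - w m"] w(2)[of n] w(2)[of m] by simp
  qed
  have "Cauchy w"
  proof (rule metric_CauchyI)
    fix e :: real assume e: "0 < e"
    \<comment> \<open>With this \<open>N\<close>, each of the two terms in \<open>gap\<close> is
      below half of \<open>e\<^sup>2\<close>.\<close>
    obtain N where N: "inverse (real (Suc N)) < e\<^sup>2 / 4"
      using reals_Archimedean[of "e\<^sup>2 / 4"] e by auto
    have "dist (w m) (w n) < e" if "m \<ge> N" "n \<ge> N" for m n
    proof -
      have "inverse (real (Suc m)) \<le> inverse (real (Suc N))"
        "inverse (real (Suc n)) \<le> inverse (real (Suc N))"
        using that by (auto intro!: le_imp_inverse_le)
      then have "(norm (w m - w n))\<^sup>2 < e\<^sup>2" using gap[of m n] N by linarith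
      then show ?thesis
        unfolding dist_norm by (rule power_less_imp_less_base) (use e in simp)
    qed
    then show "\<exists>M. \<forall>m\<ge>M. \<forall>n\<ge>M. dist (w m) (w n) < e" by blast
  qed
  then obtain p where p: "w \<longlonglongrightarrow> p"
    using Cauchy_convergent convergent_def by blast
  have "p \<in> U" using Us(2) w(1) p by (rule closed_sequentially)
  have "(\<lambda>n. (norm (f - w n))\<^sup>2) \<longlonglongrightarrow> (norm (f - p))\<^sup>2"
    by (intro tendsto_intros p)
  moreover have "(\<lambda>n. d + inverse (real (Suc n))) \<longlonglongrightarrow> d + 0"
    by (intro tendsto_intros LIMSEQ_inverse_real_of_nat)
  ultimately have le: "(norm (f - p))\<^sup>2 \<le> d"
    using LIMSEQ_le[of "\<lambda>n. (norm (f - w n))\<^sup>2" _ "\<lambda>n. d + inverse (real (Suc n))" d] w(2)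
    by (auto intro: less_imp_le)
  have "norm (f - p) \<le> norm (f - u)" if "u \<in> U" for u
    using le d_le[OF that] by (metis norm_ge_zero order_trans power2_le_imp_le)
  then show thesis using \<open>p \<in> U\<close> that by blast
qed

text \<open>Since \<open>proj\<close> is a definite description, existence and uniqueness must be
  settled before anything can be read off. A nearest point serves as witness.\<close>

lemma proj_in: "closed_subspace smul U \<Longrightarrow> proj ip U f \<in> U"
  and proj_orthogonal: "closed_subspace smul U \<Longrightarrow> u \<in> U \<Longrightarrow> ip (f - proj ip U f) u = 0"
proof -
  have "proj ip U f \<in> U \<and> (\<forall>u\<in>U. ip (f - proj ip U f) u = 0)" if U: "closed_subspace smul U"
  proof -
    note Us = closed_subspaceD[OF U]
    obtain p where p: "p \<in> U" and min: "\<And>u. u \<in> U \<Longrightarrow> norm (f - p) \<le> norm (f - u)"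
      using nearest_point_exists[OF U] by metis
    have orth: "ip (f - p) u = 0" if u: "u \<in> U" for u
    proof (cases "u = 0")
      case False
      \<comment> \<open>The component of \<open>f - p\<close> along \<open>u\<close>: subtracting
        \<open>smul a u\<close> leaves a vector orthogonal to \<open>u\<close>.\<close>
      define a where "a = ip (f - p) u / ip u u"
      have "ip (f - p - smul a u) u = 0"
        using False by (simp add: ip_diff_left ip_scale_left a_def ip_self_eq_0)
      then have "ip (f - p - smul a u) (smul a u) = 0"
        by (metis ip_commute ip_scale_left mult_zero_right sconj_zero)
      from pythagoras[OF this]
      \<comment> \<open>By Pythagoras the competitor \<open>p + smul a u\<close> would be strictly
        closer to \<open>f\<close> unless \<open>smul a u\<close> vanishes, and minimality of
        \<open>p\<close> excludes the former.\<close>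
      have "(norm (f - p))\<^sup>2 = (norm (f - p - smul a u))\<^sup>2 + (norm (smul a u))\<^sup>2" by simp
      moreover have "norm (f - p) \<le> norm (f - p - smul a u)"
        using min[of "p + smul a u"] p u Us(4,6) by (simp add: diff_diff_eq)
      then have "(norm (f - p))\<^sup>2 \<le> (norm (f - p - smul a u))\<^sup>2"
        by (simp add: power_mono)
      ultimately have "smul a u = 0" by simp
      then have "a = 0" using False by simp
      then show ?thesis using False by (simp add: a_def ip_self_eq_0)
    qed simp
    \<comment> \<open>Uniqueness: \<open>q - p\<close> lies in \<open>U\<close> and is also a
      difference of two vectors orthogonal to \<open>U\<close>, so it is orthogonal to
      itself.\<close>
    have "q = p" if q: "q \<in> U \<and> (\<forall>u\<in>U. ip (f - q) u = 0)" for q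
    proof -
      have "q - p \<in> U" using q p Us(5) by simp
      then have "ip ((f - p) - (f - q)) (q - p) = 0"
        using q orth by (simp only: ip_diff_left[of "f - p"]) simp
      then show ?thesis by (simp add: ip_self_eq_0)
    qed
    then have "\<exists>!q. q \<in> U \<and> (\<forall>u\<in>U. ip (f - q) u = 0)" using p orth by blast
    from theI'[OF this] show ?thesis unfolding proj_def .
  qed
  then show "closed_subspace smul U \<Longrightarrow> proj ip U f \<in> U"
    "closed_subspace smul U \<Longrightarrow> u \<in> U \<Longrightarrow> ip (f - proj ip U f) u = 0" by auto
qed

text \<open>The remainder \<open>f - proj ip U f\<close> is orthogonal to \<open>u\<close>. Hence a
  local frame vector cannot distinguish \<open>f\<close> from its projection.\<close>

lemma ip_proj:
  assumes "closed_subspace smul U" "u \<in> U"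
  shows "ip (proj ip U f) u = ip f u"
  using proj_orthogonal[OF assms, of f] by (simp add: ip_diff_left)

section \<open>Convergence of synthesis series and bounds of the global frame\<close>

text \<open>The upper frame bound gives \<open>\<parallel>x\<parallel>\<^sup>2 = \<Sum>j\<in>F. c j * ip (\<psi> j) x \<le> \<parallel>c\<parallel> * sqrt B * \<parallel>x\<parallel>\<close> for every
  partial sum \<open>x = \<Sum>j\<in>F. smul (c j) (\<psi> j)\<close>, hence unconditional convergence.\<close>

lemma frame_synthesis:
  assumes fr: "frame_with_bounds ip K J \<psi> A B" and K: "closed_subspace smul K"
    and c: "(\<lambda>j. (norm (c j))\<^sup>2) summable_on J"
  shows "(\<lambda>j. smul (c j) (\<psi> j)) summable_on J"
    and "(norm (\<Sum>\<^sub>\<infinity>j\<in>J. smul (c j) (\<psi> j)))\<^sup>2 \<le> B * (\<Sum>\<^sub>\<infinity>j\<in>J. (norm (c j))\<^sup>2)"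
    and "(\<Sum>\<^sub>\<infinity>j\<in>J. smul (c j) (\<psi> j)) \<in> K"
proof -
  note Ks = closed_subspaceD[OF K]
  have B: "0 < B" and \<psi>: "\<And>j. j \<in> J \<Longrightarrow> \<psi> j \<in> K"
    using fr by (auto simp: frame_with_bounds_def)
  have mem: "(\<Sum>j\<in>F. smul (c j) (\<psi> j)) \<in> K" if "F \<subseteq> J" for F
    using Ks(1) that \<psi> Ks(6) by (intro subspace_sum) auto
  have bound: "(norm (\<Sum>j\<in>F. smul (c j) (\<psi> j)))\<^sup>2 \<le> B * (\<Sum>j\<in>F. (norm (c j))\<^sup>2)"
    if F: "finite F" "F \<subseteq> J" for F
  proof -
    define x where "x = (\<Sum>j\<in>F. smul (c j) (\<psi> j))"
    \<comment> \<open>Membership in \<open>K\<close> allows the upper frame inequality to be applied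
      to the partial sum itself.\<close>
    have "x \<in> K" unfolding x_def using F(2) by (rule mem)
    then have "(\<Sum>j\<in>F. (norm (ip x (\<psi> j)))\<^sup>2) \<le> B * (norm x)\<^sup>2"
      using fr F finite_sum_le_infsum[of "\<lambda>j. (norm (ip x (\<psi> j)))\<^sup>2" J F]
      by (force simp: frame_with_bounds_def)
    then have *: "L2_set (\<lambda>j. norm (ip x (\<psi> j))) F \<le> sqrt B * norm x"
      unfolding L2_set_def by (intro real_le_lsqrt) (auto simp: power_mult_distrib B less_imp_le sum_nonneg)
    have "ip x x = (\<Sum>j\<in>F. c j * ip (\<psi> j) x)"
      by (subst x_def) (simp add: ip_sum_left ip_scale_left)
    then have "(norm x)\<^sup>2 = norm (\<Sum>j\<in>F. c j * ip (\<psi> j) x)"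
      by (metis ip_self norm_of_real abs_power2)
    also have "\<dots> \<le> (\<Sum>j\<in>F. \<bar>norm (c j)\<bar> * \<bar>norm (ip x (\<psi> j))\<bar>)"
      by (rule order_trans[OF norm_sum]) (simp add: norm_mult norm_ip_commute[of x])
    also have "\<dots> \<le> L2_set (\<lambda>j. norm (c j)) F * L2_set (\<lambda>j. norm (ip x (\<psi> j))) F"
      by (rule L2_set_mult_ineq)
    also have "\<dots> \<le> L2_set (\<lambda>j. norm (c j)) F * (sqrt B * norm x)"
      using * by (intro mult_left_mono) auto
    finally have "norm x * norm x \<le> (L2_set (\<lambda>j. norm (c j)) F * sqrt B) * norm x"
      by (simp add: power2_eq_square mult_ac)
    \<comment> \<open>One factor \<open>norm x\<close> is cancelled; for \<open>x = 0\<close> the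
      right side is nonnegative anyway.\<close>
    then have "norm x \<le> L2_set (\<lambda>j. norm (c j)) F * sqrt B"
      using B by (cases "x = 0") auto
    then have "(norm x)\<^sup>2 \<le> (L2_set (\<lambda>j. norm (c j)) F * sqrt B)\<^sup>2"
      by (intro power_mono) auto
    also have "\<dots> = B * (\<Sum>j\<in>F. (norm (c j))\<^sup>2)"
      using B by (simp add: L2_set_def power_mult_distrib sum_nonneg)
    finally show ?thesis by (simp add: x_def)
  qed
  show sm: "(\<lambda>j. smul (c j) (\<psi> j)) summable_on J"
    by (rule summable_on_square_bound(1)[OF c _ B]) (use bound in auto)
  show "(norm (\<Sum>\<^sub>\<infinity>j\<in>J. smul (c j) (\<psi> j)))\<^sup>2 \<le> B * (\<Sum>\<^sub>\<infinity>j\<in>J. (norm (c j))\<^sup>2)"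
    by (rule summable_on_square_bound(2)[OF c _ B]) (use bound in auto)
  show "(\<Sum>\<^sub>\<infinity>j\<in>J. smul (c j) (\<psi> j)) \<in> K"
    by (rule has_sum_in_closed[OF has_sum_infsum[OF sm] Ks(2)]) (rule mem)
qed

text \<open>The local inequalities, applied to the projections of \<open>f\<close> and weighted by
  the squares of the \<open>v i\<close>, are summed over \<open>i\<close>. The fusion frame
  inequalities then compare the result with the norm of \<open>f\<close>, so the bounds
  multiply.\<close>

lemma global_frame_is_frame:
  assumes V: "\<And>i. i \<in> I \<Longrightarrow> closed_subspace smul (V i)" and I: "countable I"
    and loc: "0 < A" "A \<le> B" "\<And>i. i \<in> I \<Longrightarrow> frame_with_bounds ip (V i) (J i) (\<phi> i) A B"
    and fus: "0 < A'" "A' \<le> B'"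
      "\<And>f. (\<lambda>i. (v i)\<^sup>2 * (norm (proj ip (V i) f))\<^sup>2) summable_on I"
      "\<And>f. A' * (norm f)\<^sup>2 \<le> (\<Sum>\<^sub>\<infinity>i\<in>I. (v i)\<^sup>2 * (norm (proj ip (V i) f))\<^sup>2)"
      "\<And>f. (\<Sum>\<^sub>\<infinity>i\<in>I. (v i)\<^sup>2 * (norm (proj ip (V i) f))\<^sup>2) \<le> B' * (norm f)\<^sup>2"
  shows "frame_with_bounds ip UNIV (Sigma I J) (global_frame v \<phi>) (A * A') (B * B')"
  unfolding frame_with_bounds_def
proof (intro conjI ballI)
  show "countable (Sigma I J)"
    using I loc(3) by (intro countable_SIGMA) (auto simp: frame_with_bounds_def)
  show "0 < A * A'" "A * A' \<le> B * B'"
    using loc(1,2) fus(1,2) by (auto intro: mult_mono)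
  fix f
  define h where "h = (\<lambda>p. (norm (ip f (global_frame v \<phi> p)))\<^sup>2)"
  define g where "g i = (\<Sum>\<^sub>\<infinity>j\<in>J i. h (i, j))" for i
  have h: "h (i, j) = (v i)\<^sup>2 * (norm (ip (proj ip (V i) f) (\<phi> i j)))\<^sup>2" if "i \<in> I" "j \<in> J i" for i j
  proof -
    have "\<phi> i j \<in> V i" using loc(3)[OF that(1)] that(2) by (auto simp: frame_with_bounds_def)
    then show ?thesis
      using V[OF that(1)]
      by (simp add: h_def global_frame_def ip_scaleR_right ip_proj norm_mult power_mult_distrib)
  qed
  have inner: "((\<lambda>j. h (i, j)) has_sum g i) (J i)"
    "A * ((v i)\<^sup>2 * (norm (proj ip (V i) f))\<^sup>2) \<le> g i"
    "g i \<le> B * ((v i)\<^sup>2 * (norm (proj ip (V i) f))\<^sup>2)" if i: "i \<in> I" for i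
  proof -
    let ?q = "proj ip (V i) f"
    let ?s = "\<Sum>\<^sub>\<infinity>j\<in>J i. (norm (ip ?q (\<phi> i j)))\<^sup>2"
    have fr: "(\<lambda>j. (norm (ip ?q (\<phi> i j)))\<^sup>2) summable_on J i"
      "A * (norm ?q)\<^sup>2 \<le> ?s" "?s \<le> B * (norm ?q)\<^sup>2"
      using loc(3)[OF i] proj_in[OF V[OF i], of f] by (auto simp: frame_with_bounds_def)
    have "((\<lambda>j. (v i)\<^sup>2 * (norm (ip ?q (\<phi> i j)))\<^sup>2) has_sum (v i)\<^sup>2 * ?s) (J i)"
      using fr(1) by (intro has_sum_cmult_right has_sum_infsum)
    then have hs: "((\<lambda>j. h (i, j)) has_sum (v i)\<^sup>2 * ?s) (J i)"
      using h[OF i] by (subst has_sum_cong) auto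
    then have g: "g i = (v i)\<^sup>2 * ?s" unfolding g_def by (rule infsumI)
    show "((\<lambda>j. h (i, j)) has_sum g i) (J i)" using hs g by simp
    show "A * ((v i)\<^sup>2 * (norm ?q)\<^sup>2) \<le> g i"
      using mult_left_mono[OF fr(2), of "(v i)\<^sup>2"] by (simp add: g mult_ac)
    show "g i \<le> B * ((v i)\<^sup>2 * (norm ?q)\<^sup>2)"
      using mult_left_mono[OF fr(3), of "(v i)\<^sup>2"] by (simp add: g mult_ac)
  qed
  have sm: "(\<lambda>i. C * ((v i)\<^sup>2 * (norm (proj ip (V i) f))\<^sup>2)) summable_on I" for C
    using fus(3) by (rule summable_on_cmult_right)
  have inf: "(\<Sum>\<^sub>\<infinity>i\<in>I. C * ((v i)\<^sup>2 * (norm (proj ip (V i) f))\<^sup>2))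
      = C * (\<Sum>\<^sub>\<infinity>i\<in>I. (v i)\<^sup>2 * (norm (proj ip (V i) f))\<^sup>2)" for C
    using fus(3) by (intro infsum_cmult_right)
  have g0: "0 \<le> g i" for i unfolding g_def by (intro infsum_nonneg) (simp add: h_def)
  have gs: "g summable_on I"
    using sm[of B] by (rule summable_on_comparison_test) (use inner(3) g0 in auto)
  \<comment> \<open>As \<open>h\<close> is nonnegative, convergence of the iterated sum gives
    convergence over all pairs.\<close>
  have hsm: "h summable_on Sigma I J"
    by (rule summable_on_SigmaI[OF inner(1) gs]) (auto simp: h_def)
  then show "(\<lambda>p. (norm (ip f (global_frame v \<phi> p)))\<^sup>2) summable_on Sigma I J"
    by (simp add: h_def)
  have eq: "(\<Sum>\<^sub>\<infinity>p\<in>Sigma I J. (norm (ip f (global_frame v \<phi> p)))\<^sup>2) = infsum g I"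
    using infsum_Sigma_banach[OF hsm] by (simp add: g_def[symmetric]) (simp add: h_def)
  have "A * A' * (norm f)\<^sup>2 \<le> A * (\<Sum>\<^sub>\<infinity>i\<in>I. (v i)\<^sup>2 * (norm (proj ip (V i) f))\<^sup>2)"
    using mult_left_mono[OF fus(4), of A] loc(1) by (simp add: mult_ac)
  also have "\<dots> \<le> infsum g I"
    unfolding inf[symmetric] by (rule infsum_mono[OF sm gs inner(2)])
  finally show "A * A' * (norm f)\<^sup>2 \<le> (\<Sum>\<^sub>\<infinity>p\<in>Sigma I J. (norm (ip f (global_frame v \<phi> p)))\<^sup>2)"
    by (simp add: eq)
  have "infsum g I \<le> B * (\<Sum>\<^sub>\<infinity>i\<in>I. (v i)\<^sup>2 * (norm (proj ip (V i) f))\<^sup>2)"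
    unfolding inf[symmetric] by (rule infsum_mono[OF gs sm inner(3)])
  also have "\<dots> \<le> B * B' * (norm f)\<^sup>2"
    using mult_left_mono[OF fus(5), of B] loc(1,2) by (simp add: mult_ac)
  finally show "(\<Sum>\<^sub>\<infinity>p\<in>Sigma I J. (norm (ip f (global_frame v \<phi> p)))\<^sup>2) \<le> B * B' * (norm f)\<^sup>2"
    by (simp add: eq)
qed simp

section \<open>From local to global series in a fusion frame system\<close>

lemma fusion_frame_systemD:
  assumes "fusion_frame_system smul ip I V v J \<phi>"
  shows "fusion_frame smul ip I V v"
    and "\<exists>A B. 0 < A \<and> A \<le> B \<and> (\<forall>i\<in>I. frame_with_bounds ip (V i) (J i) (\<phi> i) A B)"
  using assms unfolding fusion_frame_system_def by simp_all

lemma fusion_frame_system_closed_subspace: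
  "fusion_frame_system smul ip I V v J \<phi> \<Longrightarrow> i \<in> I \<Longrightarrow> closed_subspace smul (V i)"
  by (simp add: fusion_frame_system_def fusion_frame_def)

lemma fusion_frame_system_local_in:
  assumes "fusion_frame_system smul ip I V v J \<phi>" "i \<in> I" "j \<in> J i"
  shows "\<phi> i j \<in> V i"
  using fusion_frame_systemD(2)[OF assms(1)] assms(2,3)
  unfolding frame_with_bounds_def by (elim conjE exE) (simp (no_asm_simp))

lemma fusion_frame_system_summable:
  assumes "fusion_frame_system smul ip I V v J \<phi>"
  shows "(\<lambda>i. (v i)\<^sup>2 * (norm (proj ip (V i) f))\<^sup>2) summable_on I"
  using fusion_frame_systemD(1)[OF assms] unfolding fusion_frame_def
  by (elim conjE exE allE[where x = f]) assumption

lemma fusion_frame_system_global_frame: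
  assumes sys: "fusion_frame_system smul ip I V v J \<phi>"
  obtains A B where "frame_with_bounds ip UNIV (Sigma I J) (global_frame v \<phi>) A B"
proof -
  obtain A B where loc: "0 < A" "A \<le> B"
    "\<And>i. i \<in> I \<Longrightarrow> frame_with_bounds ip (V i) (J i) (\<phi> i) A B"
    using fusion_frame_systemD(2)[OF sys] by blast
  obtain A' B' where fus: "0 < A'" "A' \<le> B'"
      "\<And>f. (\<lambda>i. (v i)\<^sup>2 * (norm (proj ip (V i) f))\<^sup>2) summable_on I"
      "\<And>f. A' * (norm f)\<^sup>2 \<le> (\<Sum>\<^sub>\<infinity>i\<in>I. (v i)\<^sup>2 * (norm (proj ip (V i) f))\<^sup>2)"
      "\<And>f. (\<Sum>\<^sub>\<infinity>i\<in>I. (v i)\<^sup>2 * (norm (proj ip (V i) f))\<^sup>2) \<le> B' * (norm f)\<^sup>2"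
    using fusion_frame_systemD(1)[OF sys] unfolding fusion_frame_def by blast
  have "countable I"
    using sys by (simp add: fusion_frame_system_def fusion_frame_def)
  from global_frame_is_frame[OF fusion_frame_system_closed_subspace[OF sys] this loc fus]
  show thesis by (rule that)
qed

text \<open>The common core of the synthesis and frame operator identities: \<open>c\<close> will be
  an arbitrary coefficient family in the first and the analysis coefficients of \<open>f\<close> in
  the second.\<close>

lemma infsum_global_frame:
  assumes sys: "fusion_frame_system smul ip I V v J \<phi>"
    and c: "(\<lambda>p. (norm (c p))\<^sup>2) summable_on Sigma I J"
  shows "(\<Sum>\<^sub>\<infinity>p\<in>Sigma I J. smul (c p) (global_frame v \<phi> p)) =
    fusion_synthesis I V v (\<lambda>i\<in>I. \<Sum>\<^sub>\<infinity>j\<in>J i. smul (c (i, j)) (\<phi> i j))"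
proof -
  note V = fusion_frame_system_closed_subspace[OF sys]
  obtain A B where loc: "\<And>i. i \<in> I \<Longrightarrow> frame_with_bounds ip (V i) (J i) (\<phi> i) A B"
    using fusion_frame_systemD(2)[OF sys] by blast
  obtain A' B' where glob: "frame_with_bounds ip UNIV (Sigma I J) (global_frame v \<phi>) A' B'"
    using sys by (rule fusion_frame_system_global_frame)
  define d where "d i = (\<Sum>\<^sub>\<infinity>j\<in>J i. smul (c (i, j)) (\<phi> i j))" for i
  have ci: "(\<lambda>j. (norm (c (i, j)))\<^sup>2) summable_on J i" if "i \<in> I" for i
    using summable_on_SigmaD1[of "\<lambda>i j. (norm (c (i, j)))\<^sup>2" I J] c that by (simp add: case_prod_unfold)
  \<comment> \<open>The upper bound \<open>B\<close> shared by all local frames makes the local sums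
    \<open>d i\<close> square summable over \<open>I\<close>, hence an admissible argument of
    \<open>fusion_synthesis\<close>.\<close>
  have d: "d i \<in> V i" "(norm (d i))\<^sup>2 \<le> B * (\<Sum>\<^sub>\<infinity>j\<in>J i. (norm (c (i, j)))\<^sup>2)" if "i \<in> I" for i
    unfolding d_def using frame_synthesis[OF loc V ci] that by auto
  have "(\<lambda>i. \<Sum>\<^sub>\<infinity>j\<in>J i. (norm (c (i, j)))\<^sup>2) summable_on I"
    using summable_on_Sigma_banach[of "\<lambda>i j. (norm (c (i, j)))\<^sup>2"] c by (simp add: case_prod_unfold)
  then have "(\<lambda>i. B * (\<Sum>\<^sub>\<infinity>j\<in>J i. (norm (c (i, j)))\<^sup>2)) summable_on I"
    by (rule summable_on_cmult_right)
  then have "(\<lambda>i. (norm (d i))\<^sup>2) summable_on I"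
    by (rule summable_on_comparison_test) (use d(2) in auto)
  then have mem: "restrict d I \<in> hilbert_sum I V (\<lambda>_. norm)"
    using d(1) by (simp add: hilbert_sum_def cong: summable_on_cong)
  have "(\<Sum>\<^sub>\<infinity>p\<in>Sigma I J. smul (c p) (global_frame v \<phi> p))
      = (\<Sum>\<^sub>\<infinity>i\<in>I. \<Sum>\<^sub>\<infinity>j\<in>J i. smul (c (i, j)) (global_frame v \<phi> (i, j)))"
    \<comment> \<open>Summing over \<open>j\<close> first requires convergence over all pairs. The
      upper bound of the global frame on the whole space provides it.\<close>
    by (rule infsum_Sigma_banach[symmetric], rule frame_synthesis(1)[OF glob closed_subspace_UNIV c])
  also have "\<dots> = (\<Sum>\<^sub>\<infinity>i\<in>I. v i *\<^sub>R d i)"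
    by (simp add: global_frame_def smul_scaleR_right infsum_scaleR_right d_def)
  also have "\<dots> = fusion_synthesis I V v (restrict d I)"
    using mem by (simp add: fusion_synthesis_def cong: infsum_cong)
  finally show ?thesis by (simp add: d_def[abs_def])
qed

text \<open>Square summability is the convergence part of the fusion frame condition, with each
  weight moved inside the norm.\<close>

lemma fusion_analysis_in_hilbert_sum:
  assumes "fusion_frame_system smul ip I V v J \<phi>"
  shows "fusion_analysis ip I V v f \<in> hilbert_sum I V (\<lambda>_. norm)"
proof -
  note V = fusion_frame_system_closed_subspace[OF assms]
  have "v i *\<^sub>R proj ip (V i) f \<in> V i" if "i \<in> I" for i
    using closed_subspaceD(7)[OF V[OF that]] proj_in[OF V[OF that]] by blast
  moreover have "(\<lambda>i. (norm (v i *\<^sub>R proj ip (V i) f))\<^sup>2) summable_on I"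
    using fusion_frame_system_summable[OF assms, of f] by (simp add: power_mult_distrib)
  ultimately show ?thesis
    by (simp add: hilbert_sum_def fusion_analysis_def cong: summable_on_cong)
qed

text \<open>Both sides equal \<open>v i\<close> times \<open>ip f (\<phi> i j)\<close>: the weight
  is real and leaves either argument unchanged, while \<open>ip_proj\<close> removes the
  projection.\<close>

lemma ip_fusion_analysis:
  assumes "fusion_frame_system smul ip I V v J \<phi>" "i \<in> I" "j \<in> J i"
  shows "ip (fusion_analysis ip I V v f i) (\<phi> i j) = ip f (global_frame v \<phi> (i, j))"
  using ip_proj[OF fusion_frame_system_closed_subspace fusion_frame_system_local_in, OF assms(1,2) assms]
    assms(2)
  by (simp add: fusion_analysis_def global_frame_def ip_scaleR_left ip_scaleR_right)

end

section \<open>Coefficient spaces and their splitting\<close>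

lemma l2_iff: "c \<in> l2 J \<longleftrightarrow> c \<in> extensional J \<and> (\<lambda>j. (norm (c j))\<^sup>2) summable_on J"
  by (auto simp: l2_def hilbert_sum_def PiE_def)

lemma l2_norm_square: "(l2_norm J c)\<^sup>2 = (\<Sum>\<^sub>\<infinity>j\<in>J. (norm (c j))\<^sup>2)"
  by (simp add: l2_norm_def hilbert_sum_norm_def infsum_nonneg)

text \<open>Square summability over all pairs gives square summable rows, and the sums of their
  squares, which are the squared row norms, are again summable.\<close>

lemma l2_split_in_hilbert_sum:
  assumes c: "c \<in> l2 (Sigma I J)"
  shows "l2_split I J c \<in> hilbert_sum I (\<lambda>i. l2 (J i)) (\<lambda>i. l2_norm (J i))"
proof -
  have sm: "(\<lambda>(i, j). (norm (c (i, j)))\<^sup>2) summable_on Sigma I J"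
    using c by (simp add: l2_iff case_prod_unfold)
  have "(\<lambda>j. (norm (c (i, j)))\<^sup>2) summable_on J i" if "i \<in> I" for i
    using summable_on_SigmaD1[OF sm that] .
  moreover have "(\<lambda>i. \<Sum>\<^sub>\<infinity>j\<in>J i. (norm (c (i, j)))\<^sup>2) summable_on I"
    using summable_on_Sigma_banach[OF sm] .
  ultimately show ?thesis
    using c by (simp add: hilbert_sum_def l2_split_def l2_norm_square l2_iff cong: summable_on_cong infsum_cong)
qed

section \<open>The three operator identities\<close>

theorem proposition4p2:
  fixes smul :: "'k::hilbert_scalar \<Rightarrow> 'a::{banach,second_countable_topology} \<Rightarrow> 'a"
    and ip :: "'a \<Rightarrow> 'a \<Rightarrow> 'k"
    and I :: "'i set" and V :: "'i \<Rightarrow> 'a set" and v :: "'i \<Rightarrow> real"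
    and J :: "'i \<Rightarrow> 'j set" and \<phi> :: "'i \<Rightarrow> 'j \<Rightarrow> 'a"
  assumes "hilbert_space smul ip"
    and "fusion_frame_system smul ip I V v J \<phi>"
  shows "synthesis smul (Sigma I J) (global_frame v \<phi>) =
      restrict
        (fusion_synthesis I V v
          \<circ> hilbert_sum_op I (\<lambda>i. l2 (J i)) (\<lambda>i. l2_norm (J i)) (\<lambda>i. synthesis smul (J i) (\<phi> i))
          \<circ> l2_split I J)
        (l2 (Sigma I J)) \<and>
    l2_split I J \<circ> analysis ip UNIV (Sigma I J) (global_frame v \<phi>) =
      hilbert_sum_op I V (\<lambda>_. norm) (\<lambda>i. analysis ip (V i) (J i) (\<phi> i)) \<circ> fusion_analysis ip I V v \<and>
    frame_operator smul ip UNIV (Sigma I J) (global_frame v \<phi>) =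
      fusion_synthesis I V v
        \<circ> hilbert_sum_op I V (\<lambda>_. norm) (\<lambda>i. frame_operator smul ip (V i) (J i) (\<phi> i))
        \<circ> fusion_analysis ip I V v"
proof (rule conjI[OF ext conjI[OF ext ext]])
  interpret hilbert_space smul ip by fact
  note sys = assms(2)
  show "synthesis smul (Sigma I J) (global_frame v \<phi>) c =
      restrict
        (fusion_synthesis I V v
          \<circ> hilbert_sum_op I (\<lambda>i. l2 (J i)) (\<lambda>i. l2_norm (J i)) (\<lambda>i. synthesis smul (J i) (\<phi> i))
          \<circ> l2_split I J)
        (l2 (Sigma I J)) c" for c
  \<comment> \<open>Outside \<open>l2 (Sigma I J)\<close> both sides are \<open>undefined\<close>.
    On the right this is the effect of the outer \<open>restrict\<close>, since a bare composition
    would apply further operators to \<open>undefined\<close>.\<close>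
  proof (cases "c \<in> l2 (Sigma I J)")
    case True
    have split: "l2_split I J c \<in> hilbert_sum I (\<lambda>i. l2 (J i)) (\<lambda>i. l2_norm (J i))"
      using True by (rule l2_split_in_hilbert_sum)
    then have "l2_split I J c i \<in> l2 (J i)" if "i \<in> I" for i
      using that by (auto simp: hilbert_sum_def)
    then have "synthesis smul (J i) (\<phi> i) (l2_split I J c i) = (\<Sum>\<^sub>\<infinity>j\<in>J i. smul (c (i, j)) (\<phi> i j))"
      if "i \<in> I" for i
      using that True by (auto simp: synthesis_def l2_split_def intro!: infsum_cong)
    then have "hilbert_sum_op I (\<lambda>i. l2 (J i)) (\<lambda>i. l2_norm (J i)) (\<lambda>i. synthesis smul (J i) (\<phi> i))
        (l2_split I J c) = (\<lambda>i\<in>I. \<Sum>\<^sub>\<infinity>j\<in>J i. smul (c (i, j)) (\<phi> i j))"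
      using split by (simp add: hilbert_sum_op_def cong: restrict_cong)
    then show ?thesis
      using True infsum_global_frame[OF sys, of c] by (simp add: synthesis_def l2_iff)
  qed (simp add: synthesis_def)

  obtain A B where glob: "frame_with_bounds ip UNIV (Sigma I J) (global_frame v \<phi>) A B"
    using sys by (rule fusion_frame_system_global_frame)
  have coeff: "(\<lambda>p. (norm (ip f (global_frame v \<phi> p)))\<^sup>2) summable_on Sigma I J" for f
    using glob by (simp add: frame_with_bounds_def)
  let ?C = "fusion_analysis ip I V v"
  have mem: "?C f \<in> hilbert_sum I V (\<lambda>_. norm)" for f
    using sys by (rule fusion_analysis_in_hilbert_sum)
  have memi: "?C f i \<in> V i" if "i \<in> I" for f i
    using mem[of f] that by (auto simp: hilbert_sum_def)
  show "(l2_split I J \<circ> analysis ip UNIV (Sigma I J) (global_frame v \<phi>)) f =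
      (hilbert_sum_op I V (\<lambda>_. norm) (\<lambda>i. analysis ip (V i) (J i) (\<phi> i)) \<circ> ?C) f" for f
  proof -
    \<comment> \<open>\<open>l2_split\<close> acts entrywise only on its domain, so the analysis
      coefficients must first be known to be square summable.\<close>
    have "analysis ip UNIV (Sigma I J) (global_frame v \<phi>) f \<in> l2 (Sigma I J)"
      using coeff[of f] by (simp add: analysis_def l2_iff cong: summable_on_cong)
    then have "l2_split I J (analysis ip UNIV (Sigma I J) (global_frame v \<phi>) f) =
        (\<lambda>i\<in>I. \<lambda>j\<in>J i. ip f (global_frame v \<phi> (i, j)))"
      by (auto simp: l2_split_def analysis_def intro!: restrict_ext)
    also have "\<dots> = (\<lambda>i\<in>I. analysis ip (V i) (J i) (\<phi> i) (?C f i))"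
      using memi by (auto simp: analysis_def ip_fusion_analysis[OF sys] intro!: restrict_ext)
    finally show ?thesis
      using mem by (simp add: hilbert_sum_op_def)
  qed

  show "frame_operator smul ip UNIV (Sigma I J) (global_frame v \<phi>) f =
      (fusion_synthesis I V v
        \<circ> hilbert_sum_op I V (\<lambda>_. norm) (\<lambda>i. frame_operator smul ip (V i) (J i) (\<phi> i)) \<circ> ?C) f" for f
  proof -
    have "frame_operator smul ip UNIV (Sigma I J) (global_frame v \<phi>) f =
        fusion_synthesis I V v (\<lambda>i\<in>I. \<Sum>\<^sub>\<infinity>j\<in>J i. smul (ip f (global_frame v \<phi> (i, j))) (\<phi> i j))"
      using infsum_global_frame[OF sys coeff[of f]] by (simp add: frame_operator_def)
    \<comment> \<open>The coefficients of \<open>f\<close> against the global family are those of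
      \<open>?C f i\<close> against the local one, so each inner series is a local frame
      operator.\<close>
    also have "(\<lambda>i\<in>I. \<Sum>\<^sub>\<infinity>j\<in>J i. smul (ip f (global_frame v \<phi> (i, j))) (\<phi> i j)) =
        (\<lambda>i\<in>I. frame_operator smul ip (V i) (J i) (\<phi> i) (?C f i))"
      using memi
      by (intro restrict_ext) (auto simp: frame_operator_def ip_fusion_analysis[OF sys] intro!: infsum_cong)
    finally show ?thesis
      using mem[of f] by (simp add: hilbert_sum_op_def restrict_def)
  qed
qed

end
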